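(* Let $R,R_0,r,P,\sigma,C$ be as in the context. Let $b>1$, $d>-1$, and let $\rho$ be a strictly positive bounded function on $(0,1]$ with $\rho(1)=1$ such that $$n(1/x)=x^b(1-x)^d\,\frac{\rho(x)}{\sigma(x^{-1})},\qquad x\in(0,1],$$ solves the balance equation $$\int_{1}^s \sigma(y)\,R(s/y)\,n(y)\,dy=\bigl(s-P(s)+s\,\sigma(s)R_0\bigr)\,n(s).$$ (i) For all continuous demand functions $\sigma$ with $\sigma(1)=1$, the relation $d=\dfrac{R(1)}{C(1)}-1$ is necessary for the continuity of $\rho$ at the point $x=1$. (ii) Continuity of the strictly positive function $\rho$ at the point $x=0$ implies $b=b_\ell=3$ for $\ell$-demand, $b=b_u=2$ for $u$-demand, and $b=b_s>2$ for $s$-demand; more precisely, $b_s$ satisfies the transcendental equation $$\int_1^\infty s^{\,b_s-2}\,r(s)\,ds=1+\frac{1}{S_0R_0}.$$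
   Context: The price scale is normalized so that the minimal income is $1$; $n(s)$, $s\ge1$, is the density of agents with net income $s$. The pair-interaction intensity $R:[1,\infty)\to[0,\infty)$ is integrable with $R_0=\int_1^\infty R(y)\,dy$; the probability density $r=R/R_0$ on $[1,\infty)$ is bounded and continuous with $r(1)>0$. The welfare function $P$ on $[1,\infty)$ is decreasing, vanishes for all sufficiently large $s$, and satisfies the minimal-income relation $1-P(1)+\sigma(1)R_0=0$. The demand $\sigma$ is a monotone function with $\sigma(s)\le s$. The demand classes (smooth $\sigma$) are: - $\ell$-demand: $\sigma(s)=s$ for all $s>1$; - $s$-demand: $\sigma(s)=s$ on some interval $[1,1/x_*]$, $x_*\in(0,1)$, and $\sigma(s)\to S_0<\infty$ as $s\to\infty$; - $u$-demand: $\sigma(s)=s$ on some interval $[1,1/x_*]$, $x_*\in(0,1)$, and as $s\to\infty$, $\sigma(s)\to\infty$ and $\sigma(st)/\sigma(s)\to1$. The function $C$ is defined by $$s-P(s)+s\,\sigma(s)R_0=\sigma(s)(s-1)\,C(s^{-1}),\qquad s>1,$$ with limit values $C(0)=R_0+\sigma(\infty)^{-1}$ (where $1/\infty=0$) and $C(1)=1+2R_0-P'(1)>0$; it is assumed that $C(x)/C(0)$ is bounded below by a positive constant on $(0,1]$.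
   Formalization: For ℓ-demand the printed b=3 is false for the printed profile (which divides by σ(1/x)=1/x); the proved conclusion is b=2 together with n(1/x)=x^3(1-x)^d ρ(x), so 3 is the exponent of the density n. Continuity of ρ at 0 is taken with ρ(0)>0. *)

theory Defs
  imports "HOL-Analysis.Analysis"
begin

text \<open>
  All functions of the income live on \<open>[1,\<infinity>)\<close> and \<open>C\<close> on \<open>[0,1]\<close>; values outside are irrelevant.
  \<open>dP\<close> is the (one-sided) derivative \<open>P'(1)\<close>. That \<open>C(0)\<close> and \<open>C(1)\<close> are limit values
  of \<open>C\<close> is recorded by the last two assumptions. The one at \<open>1\<close> has content for a demand that is merely
  continuous: it is equivalent to \<open>\<sigma>'(1) = 1\<close> there.
\<close>

locale income_model =
  fixes R :: "real \<Rightarrow> real" and R0 :: real and r :: "real \<Rightarrow> real"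
    and P :: "real \<Rightarrow> real" and dP :: real
    and \<sigma> :: "real \<Rightarrow> real" and C :: "real \<Rightarrow> real"
  assumes R_nonneg: "\<And>y. 1 \<le> y \<Longrightarrow> 0 \<le> R y"
    and R_integral: "(R has_integral R0) {1..}"
    and R0_pos: "0 < R0"
    and r_eq: "\<And>y. 1 \<le> y \<Longrightarrow> r y = R y / R0"
    and r_bounded: "bounded (r ` {1..})"
    and r_continuous: "continuous_on {1..} r"
    and r_1: "0 < r 1"
    and P_decreasing: "antimono_on {1..} P"
    and P_vanishes: "\<forall>\<^sub>F s in at_top. P s = 0"
    and P_deriv: "(P has_real_derivative dP) (at 1 within {1..})"
    and minimal_income: "1 - P 1 + \<sigma> 1 * R0 = 0"
    and demand_mono: "mono_on {1..} \<sigma>"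
    and demand_le: "\<And>s. 1 \<le> s \<Longrightarrow> \<sigma> s \<le> s"
    and C_eq: "\<And>s. 1 < s \<Longrightarrow> s - P s + s * \<sigma> s * R0 = \<sigma> s * (s - 1) * C (1 / s)"
    and C_0_finite: "\<And>S. (\<sigma> \<longlongrightarrow> S) at_top \<Longrightarrow> C 0 = R0 + 1 / S"
    and C_0_infinite: "filterlim \<sigma> at_top at_top \<Longrightarrow> C 0 = R0"
    and C_1: "C 1 = 1 + 2 * R0 - dP"
    and C_1_pos: "0 < C 1"
    and C_lower: "\<exists>c>0. \<forall>x\<in>{0<..1}. c \<le> C x / C 0"
    and C_limit_0: "(C \<longlongrightarrow> C 0) (at_right 0)"
    and C_limit_1: "(C \<longlongrightarrow> C 1) (at_left 1)"

text \<open>Smoothness of the demand is only required in the weakest usual sense, \<open>C\<^sup>1\<close> up to the boundary.\<close>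

definition smooth_demand :: "(real \<Rightarrow> real) \<Rightarrow> bool" where
  "smooth_demand \<sigma> \<longleftrightarrow>
     (\<exists>\<sigma>'. (\<forall>s\<ge>1. (\<sigma> has_real_derivative \<sigma>' s) (at s within {1..})) \<and> continuous_on {1..} \<sigma>')"

definition l_demand :: "(real \<Rightarrow> real) \<Rightarrow> bool" where
  "l_demand \<sigma> \<longleftrightarrow> smooth_demand \<sigma> \<and> (\<forall>s>1. \<sigma> s = s)"

definition s_demand :: "(real \<Rightarrow> real) \<Rightarrow> real \<Rightarrow> bool" where
  "s_demand \<sigma> S0 \<longleftrightarrow> smooth_demand \<sigma> \<and>
     (\<exists>x\<in>{0<..<1}. \<forall>s\<in>{1..1/x}. \<sigma> s = s) \<and> (\<sigma> \<longlongrightarrow> S0) at_top"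

definition u_demand :: "(real \<Rightarrow> real) \<Rightarrow> bool" where
  "u_demand \<sigma> \<longleftrightarrow> smooth_demand \<sigma> \<and>
     (\<exists>x\<in>{0<..<1}. \<forall>s\<in>{1..1/x}. \<sigma> s = s) \<and>
     filterlim \<sigma> at_top at_top \<and>
     (\<forall>t>0. ((\<lambda>s. \<sigma> (s * t) / \<sigma> s) \<longlongrightarrow> 1) at_top)"

text \<open>The integrand may be singular at \<open>y = 1\<close>; \<open>has_integral\<close> includes the existence of the integral.\<close>

definition solves_balance ::
  "(real \<Rightarrow> real) \<Rightarrow> real \<Rightarrow> (real \<Rightarrow> real) \<Rightarrow> (real \<Rightarrow> real) \<Rightarrow> (real \<Rightarrow> real) \<Rightarrow> bool" where
  "solves_balance R R0 P \<sigma> n \<longleftrightarrow>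
     (\<forall>s\<ge>1. ((\<lambda>y. \<sigma> y * R (s / y) * n y) has_integral (s - P s + s * \<sigma> s * R0) * n s) {1..s})"

text \<open>
  The endpoint \<open>x = 1\<close> is left out: for \<open>d < 0\<close> the right-hand side is infinite there, and for
  \<open>d = 0\<close> the convention \<open>0 powr 0 = 0\<close> would give a wrong value. The balance equation does not
  depend on \<open>n 1\<close>.
\<close>

definition has_profile ::
  "(real \<Rightarrow> real) \<Rightarrow> (real \<Rightarrow> real) \<Rightarrow> real \<Rightarrow> real \<Rightarrow> (real \<Rightarrow> real) \<Rightarrow> bool" where
  "has_profile n \<sigma> b d \<rho> \<longleftrightarrow>
     (\<forall>x\<in>{0<..<1}. n (1 / x) = x powr b * (1 - x) powr d * (\<rho> x / \<sigma> (1 / x)))"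

end

theory Submission
  imports Defs
begin

text \<open>
  Write \<open>g = \<sigma> n\<close>, so that \<open>g y = y\<^sup>-\<^sup>b (1 - 1/y)\<^sup>d \<rho>(1/y)\<close> and the balance equation becomes
  \<open>\<integral>\<^sub>1\<^sup>s R(s/y) g(y) dy = (s - 1) C(1/s) g(s)\<close>.
  As \<open>s \<rightarrow> 1\<close>, the left-hand side is asymptotic to \<open>R(1) (s - 1)\<^bsup>d+1\<^esup> / (d + 1)\<close> and the right-hand side to
  \<open>C(1) (s - 1)\<^bsup>d+1\<^esup>\<close>, which gives (i).
  For (ii), multiply by \<open>s\<^bsup>b-2-e\<^esup>\<close> and integrate: by Tonelli the \<open>(b - 2 - e)\<close>-th moment of \<open>R\<close> is the average
  of \<open>(1 - 1/s) C(1/s)\<close> with respect to the normalised measure \<open>s\<^bsup>b-1-e\<^esup> g(s) ds\<close>. Its mass escapes to infinity as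
  \<open>e \<rightarrow> 0\<close>, so the \<open>(b - 2)\<close>-th moment of \<open>R\<close> equals \<open>C(0)\<close>.
\<close>

section \<open>Mellin transforms and moments of a kernel\<close>

text \<open>Tonelli's theorem exchanges the integrals, and the substitution s = y t in the inner one
  separates the variables: \<open>s powr p\<close> contributes \<open>y powr p\<close> and the
  Jacobian one more factor y. The bases of all powers that matter are positive, because
  \<open>K\<close> and \<open>g\<close> vanish to the left of 1.\<close>

lemma nn_integral_Mellin_convolution:
  fixes K g :: "real \<Rightarrow> real"
  assumes [measurable]: "K \<in> borel_measurable borel" "g \<in> borel_measurable borel"
    and K_nonneg: "\<And>t. 0 \<le> K t" and K_0: "\<And>t. t < 1 \<Longrightarrow> K t = 0"
    and g_nonneg: "\<And>y. 0 \<le> g y" and g_0: "\<And>y. y \<le> 1 \<Longrightarrow> g y = 0"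
  shows "(\<integral>\<^sup>+s. ennreal (s powr p) * (\<integral>\<^sup>+y. ennreal (K (s / y) * g y) \<partial>lborel) \<partial>lborel) =
    (\<integral>\<^sup>+t. ennreal (t powr p * K t) \<partial>lborel) * (\<integral>\<^sup>+y. ennreal (y powr (p + 1) * g y) \<partial>lborel)"
proof -
  have inner: "(\<integral>\<^sup>+s. ennreal (s powr p * (K (s / y) * g y)) \<partial>lborel) =
      (\<integral>\<^sup>+t. ennreal (t powr p * K t) \<partial>lborel) * ennreal (y powr (p + 1) * g y)" for y
  proof (cases "y \<le> 1")
    case False
    have eq: "ennreal ((y * t) powr p * (K t * g y)) =
        ennreal (t powr p * K t) * ennreal (y powr p * g y)" for t
      using False K_nonneg[of t] g_nonneg[of y] K_0[of t]
      by (cases "t < 1") (simp_all add: powr_mult ennreal_mult' [symmetric] mult_ac)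
    have "(\<integral>\<^sup>+s. ennreal (s powr p * (K (s / y) * g y)) \<partial>lborel) =
        ennreal \<bar>y\<bar> * (\<integral>\<^sup>+t. ennreal ((0 + y * t) powr p * (K ((0 + y * t) / y) * g y)) \<partial>lborel)"
      using False by (intro nn_integral_real_affine) auto
    also have "\<dots> = ennreal y * ((\<integral>\<^sup>+t. ennreal (t powr p * K t) \<partial>lborel) * ennreal (y powr p * g y))"
      using False by (simp add: eq nn_integral_multc)
    also have "\<dots> = (\<integral>\<^sup>+t. ennreal (t powr p * K t) \<partial>lborel) * (ennreal y * ennreal (y powr p * g y))"
      by (simp add: mult_ac)
    also have "ennreal y * ennreal (y powr p * g y) = ennreal (y powr (p + 1) * g y)"
      using False g_nonneg[of y] by (simp add: powr_add ennreal_mult' [symmetric] mult_ac)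
    finally show ?thesis .
  qed (simp add: g_0)
  have "(\<integral>\<^sup>+s. ennreal (s powr p) * (\<integral>\<^sup>+y. ennreal (K (s / y) * g y) \<partial>lborel) \<partial>lborel) =
      (\<integral>\<^sup>+s. \<integral>\<^sup>+y. ennreal (s powr p * (K (s / y) * g y)) \<partial>lborel \<partial>lborel)"
    by (simp add: nn_integral_cmult ennreal_mult K_nonneg g_nonneg)
  also have "\<dots> = (\<integral>\<^sup>+y. \<integral>\<^sup>+s. ennreal (s powr p * (K (s / y) * g y)) \<partial>lborel \<partial>lborel)"
    by (rule lborel_pair.Fubini' [symmetric]) measurable
  also have "\<dots> = (\<integral>\<^sup>+t. ennreal (t powr p * K t) \<partial>lborel) * (\<integral>\<^sup>+y. ennreal (y powr (p + 1) * g y) \<partial>lborel)"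
    by (simp add: inner nn_integral_cmult)
  finally show ?thesis .
qed

lemma nn_integral_powr_to_inf:
  fixes a e c :: real
  assumes "0 < a" "0 < e" "0 \<le> c"
  shows "(\<integral>\<^sup>+y. ennreal (indicator {a..} y * (c * y powr (-1 - e))) \<partial>lborel) = ennreal (c * (a powr -e / e))"
proof -
  have "((\<lambda>y. y powr (-1 - e)) has_integral a powr -e / e) {a..}"
    using has_integral_powr_to_inf[of "-1 - e" a] assms by (simp add: field_simps)
  then have "((\<lambda>y. c * y powr (-1 - e)) has_integral c * (a powr -e / e)) {a..}"
    by (rule has_integral_mult_right)
  then have "((\<lambda>y. indicator {a..} y * (c * y powr (-1 - e))) has_integral c * (a powr -e / e)) UNIV"
    by (subst (asm) has_integral_restrict_UNIV[symmetric]) (auto elim!: has_integral_eq[rotated] simp: indicator_def)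
  then show ?thesis
    using assms by (subst (asm) has_integral_iff_nn_integral_lebesgue) (auto simp: nn_integral_completion)
qed

lemma has_integral_powr_from_1:
  fixes d s :: real
  assumes "-1 < d" "1 \<le> s"
  shows "((\<lambda>y. (y - 1) powr d) has_integral (s - 1) powr (d + 1) / (d + 1)) {1..s}"
  using has_integral_affinity[OF has_integral_powr_from_0[of d "s - 1", unfolded box_real(2)[symmetric]], of 1 "-1"] assms
  by (simp add: algebra_simps)

text \<open>The damped moment of \<open>K\<close> times the damped mass of \<open>g\<close> is an
  integral of \<open>F\<close>, and \<open>F s\<close> is close to \<open>L * (s * g s)\<close> for
  large s. What a bounded range of s contributes is controlled by \<open>upper\<close> and
  \<open>local_finite\<close>, uniformly in the damping. By \<open>tail\<close> the mass is finite
  under damping but diverges as the damping is removed, so only \<open>L\<close> survives. The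
  bounds are required almost everywhere so that \<open>g\<close> may be a Borel version of a given
  density.\<close>

lemma kernel_moment_eq:
  fixes K g :: "real \<Rightarrow> real" and A L b c c' T0 :: real
  defines "F \<equiv> \<lambda>s. \<integral>\<^sup>+y. ennreal (K (s / y) * g y) \<partial>lborel"
  assumes [measurable]: "K \<in> borel_measurable borel" "g \<in> borel_measurable borel"
    and K_nonneg: "\<And>t. 0 \<le> K t" and K_0: "\<And>t. t < 1 \<Longrightarrow> K t = 0"
    and g_nonneg: "\<And>y. 0 \<le> g y" and g_0: "\<And>y. y \<le> 1 \<Longrightarrow> g y = 0"
    and L: "0 < L" and A: "0 \<le> A" and T0: "1 \<le> T0" and c: "0 < c" and c': "0 \<le> c'"
    and upper: "AE s in lborel. F s \<le> ennreal (A * (s * g s))"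
    and limit: "\<And>\<epsilon>. 0 < \<epsilon> \<Longrightarrow> \<exists>T. AE s in lborel. T \<le> s \<longrightarrow>
          ennreal ((L - \<epsilon>) * (s * g s)) \<le> F s \<and> F s \<le> ennreal ((L + \<epsilon>) * (s * g s))"
    and local_finite: "\<And>T. (\<integral>\<^sup>+y. ennreal (indicator {1..T} y * (y powr (b - 1) * g y)) \<partial>lborel) < \<infinity>"
    and tail: "AE y in lborel. T0 \<le> y \<longrightarrow> c * y powr -b \<le> g y \<and> g y \<le> c' * y powr -b"
  shows "(\<integral>\<^sup>+t. ennreal (t powr (b - 2) * K t) \<partial>lborel) = ennreal L"
proof -
  have [measurable]: "F \<in> borel_measurable borel"
    unfolding F_def by measurable
  \<comment> \<open>The exponent e > 0 is the damping: at e = 0 the lower \<open>tail\<close> bound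
    makes the mass \<open>I e\<close> infinite, and the identity \<open>MI\<close> could not be
    divided by it. \<open>J T\<close> bounds the mass on [1,T] for all e > 0 at once.\<close>
  define M where "M e = (\<integral>\<^sup>+t. ennreal (t powr (b - 2 - e) * K t) \<partial>lborel)" for e
  define I where "I e = (\<integral>\<^sup>+y. ennreal (y powr (b - 1 - e) * g y) \<partial>lborel)" for e
  define J where "J T = (\<integral>\<^sup>+y. ennreal (indicator {1..T} y * (y powr (b - 1) * g y)) \<partial>lborel)" for T
  have MI: "M e * I e = (\<integral>\<^sup>+s. ennreal (s powr (b - 2 - e)) * F s \<partial>lborel)" for e
    using nn_integral_Mellin_convolution[of K g "b - 2 - e"] K_nonneg K_0 g_nonneg g_0
    by (simp add: M_def I_def F_def algebra_simps)
  have powr1: "y powr (b - 1 - e) \<le> y powr (b - 1)" if "1 \<le> y" "0 < e" for y e :: real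
    using that by (intro powr_mono) auto
  have I_finite: "I e < \<infinity>" if e: "0 < e" for e
  proof -
    have "I e \<le> (\<integral>\<^sup>+y. ennreal (indicator {1..T0} y * (y powr (b - 1) * g y)) +
        ennreal (indicator {T0..} y * (c' * y powr (-1 - e))) \<partial>lborel)"
      unfolding I_def
    proof (rule nn_integral_mono_AE)
      show "AE y in lborel. ennreal (y powr (b - 1 - e) * g y)
         \<le> ennreal (indicator {1..T0} y * (y powr (b - 1) * g y)) +
           ennreal (indicator {T0..} y * (c' * y powr (-1 - e)))"
        using tail
      proof eventually_elim
        case (elim y)
        consider "y \<le> 1" | "1 < y" "y < T0" | "T0 \<le> y" by linarith
        then show ?case
        proof cases
          case 2
          then show ?thesis using powr1[of y e] e g_nonneg[of y]
            by (auto intro!: ennreal_leI mult_right_mono)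
        next
          case 3
          have "y powr (b - 1 - e) * g y \<le> y powr (b - 1 - e) * (c' * y powr -b)"
            using elim 3 by (intro mult_left_mono) auto
          also have "\<dots> = c' * y powr (-1 - e)"
            by (simp add: powr_add[symmetric] mult_ac)
          finally show ?thesis using 3
            by (intro add_increasing) (auto intro!: ennreal_leI)
        qed (simp add: g_0)
      qed
    qed
    also have "\<dots> = J T0 + ennreal (c' * (T0 powr -e / e))"
      using T0 e c' by (subst nn_integral_add) (auto simp: J_def nn_integral_powr_to_inf)
    also have "\<dots> < \<infinity>"
      using local_finite[of T0] by (simp add: J_def)
    finally show ?thesis .
  qed
  \<comment> \<open>For e \<le> 1 the factor \<open>T0 powr -e\<close> is at least 1 / T0; what
    remains grows like 1 / e.\<close>
  have I_ge: "ennreal (c / (T0 * e)) \<le> I e" if e: "0 < e" "e \<le> 1" for e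
  proof -
    have "c / (T0 * e) \<le> c * (T0 powr -e / e)"
    proof -
      have "T0 powr -1 \<le> T0 powr -e" using T0 e by (intro powr_mono) auto
      then have "1 / T0 \<le> T0 powr -e" using T0 by (simp add: powr_minus_divide)
      then have "c * (1 / T0 / e) \<le> c * (T0 powr -e / e)" using c e
        by (intro mult_left_mono divide_right_mono) auto
      then show ?thesis by simp
    qed
    then have "ennreal (c / (T0 * e)) \<le> ennreal (c * (T0 powr -e / e))"
      by (rule ennreal_leI)
    also have "\<dots> = (\<integral>\<^sup>+y. ennreal (indicator {T0..} y * (c * y powr (-1 - e))) \<partial>lborel)"
      using T0 e c by (subst nn_integral_powr_to_inf) auto
    also have "\<dots> \<le> I e"
      unfolding I_def
    proof (rule nn_integral_mono_AE)
      show "AE y in lborel. ennreal (indicator {T0..} y * (c * y powr (-1 - e)))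
          \<le> ennreal (y powr (b - 1 - e) * g y)"
        using tail
      proof eventually_elim
        case (elim y)
        have "c * y powr (-1 - e) = y powr (b - 1 - e) * (c * y powr -b)"
          by (simp add: powr_add[symmetric] mult_ac)
        also have "\<dots> \<le> y powr (b - 1 - e) * g y" if "T0 \<le> y"
          using elim that by (intro mult_left_mono) auto
        finally show ?case
          by (cases "T0 \<le> y") (auto intro!: ennreal_leI)
      qed
    qed
    finally show ?thesis .
  qed
  have powr2: "s powr (b - 2 - e) * s = s powr (b - 1 - e)" if "1 < s" for s e
    using that powr_add[of s "b - 2 - e" 1] by (simp add: algebra_simps)
  \<comment> \<open>\<open>B\<close> may depend on \<epsilon> through the cutoff \<open>T\<close>,
    but not on \<open>e\<close>; so the second error term vanishes once \<open>I e\<close> tends to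
    infinity.\<close>
  have sandwich: "\<exists>B. \<forall>e>0. I e > 0 \<longrightarrow> M e < \<infinity> \<and>
      \<bar>enn2real (M e) - L\<bar> \<le> \<epsilon> + B / enn2real (I e)" if \<epsilon>: "0 < \<epsilon>" "\<epsilon> < L" for \<epsilon>
  proof -
    obtain T where T: "AE s in lborel. T \<le> s \<longrightarrow>
          ennreal ((L - \<epsilon>) * (s * g s)) \<le> F s \<and> F s \<le> ennreal ((L + \<epsilon>) * (s * g s))"
      using limit[OF \<epsilon>(1)] by blast
    have F_0: "F s = 0" if "s \<le> 1" for s
    proof -
      have *: "K (s / y) * g y = 0" for y
        using that K_0[of "s / y"] g_0[of y] by (cases "y \<le> 1") auto
      show ?thesis by (simp only: F_def * ennreal_0 nn_integral_const mult_zero_left)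
    qed
    \<comment> \<open>Below the cutoff the crude bound \<open>upper\<close> costs at most
      \<open>A * J T\<close>. Above it \<open>limit\<close> applies, and extending its right-hand
      side to all s only increases it.\<close>
    have up: "M e * I e \<le> ennreal A * J T + ennreal (L + \<epsilon>) * I e" if e: "0 < e" for e
    proof -
      have "M e * I e \<le> (\<integral>\<^sup>+s. ennreal A * ennreal (indicator {1..T} s * (s powr (b - 1) * g s)) +
          ennreal (L + \<epsilon>) * ennreal (s powr (b - 1 - e) * g s) \<partial>lborel)"
        unfolding MI
      proof (rule nn_integral_mono_AE)
        show "AE s in lborel. ennreal (s powr (b - 2 - e)) * F s
          \<le> ennreal A * ennreal (indicator {1..T} s * (s powr (b - 1) * g s)) +
             ennreal (L + \<epsilon>) * ennreal (s powr (b - 1 - e) * g s)"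
          using T upper
        proof eventually_elim
          case (elim s)
          consider "s \<le> 1" | "1 < s" "s < T" | "1 < s" "T \<le> s" by linarith
          then show ?case
          proof cases
            case 1
            then show ?thesis by (simp add: F_0)
          next
            case 2
            have "ennreal (s powr (b - 2 - e)) * F s \<le> ennreal (s powr (b - 2 - e)) * ennreal (A * (s * g s))"
              using elim by (intro mult_left_mono) auto
            also have "\<dots> = ennreal (A * ((s powr (b - 2 - e) * s) * g s))"
              using A g_nonneg[of s] by (subst ennreal_mult'[symmetric]) (simp_all add: mult_ac)
            also have "\<dots> \<le> ennreal (A * (s powr (b - 1) * g s))"
              using A g_nonneg[of s] 2 e powr1[of s e] unfolding powr2[OF 2(1)]
              by (intro ennreal_leI mult_left_mono mult_right_mono) auto
            also have "\<dots> = ennreal A * ennreal (indicator {1..T} s * (s powr (b - 1) * g s))"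
              using 2 A by (simp add: ennreal_mult')
            finally show ?thesis by (simp add: add_increasing2)
          next
            case 3
            have "ennreal (s powr (b - 2 - e)) * F s \<le> ennreal (s powr (b - 2 - e)) * ennreal ((L + \<epsilon>) * (s * g s))"
              using elim 3 by (intro mult_left_mono) auto
            also have "\<dots> = ennreal ((L + \<epsilon>) * ((s powr (b - 2 - e) * s) * g s))"
              using L \<epsilon> g_nonneg[of s] by (subst ennreal_mult'[symmetric]) (simp_all add: mult_ac)
            also have "\<dots> = ennreal (L + \<epsilon>) * ennreal (s powr (b - 1 - e) * g s)"
              using L \<epsilon> unfolding powr2[OF 3(1)] by (simp add: ennreal_mult')
            finally show ?thesis by (simp add: add_increasing)
          qed
        qed
      qed
      also have "\<dots> = ennreal A * J T + ennreal (L + \<epsilon>) * I e"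
        by (simp add: nn_integral_add nn_integral_cmult J_def I_def)
      finally show ?thesis .
    qed
    \<comment> \<open>The mass below the cutoff is added on the right rather than subtracted on the
      left, because subtraction of extended nonnegative reals truncates at 0.\<close>
    have lo: "ennreal (L - \<epsilon>) * I e \<le> M e * I e + ennreal (L - \<epsilon>) * J T" if e: "0 < e" for e
    proof -
      have "ennreal (L - \<epsilon>) * I e = (\<integral>\<^sup>+s. ennreal (L - \<epsilon>) * ennreal (s powr (b - 1 - e) * g s) \<partial>lborel)"
        by (simp add: nn_integral_cmult I_def)
      also have "\<dots> \<le> (\<integral>\<^sup>+s. ennreal (s powr (b - 2 - e)) * F s +
          ennreal (L - \<epsilon>) * ennreal (indicator {1..T} s * (s powr (b - 1) * g s)) \<partial>lborel)"
      proof (rule nn_integral_mono_AE)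
        show "AE s in lborel. ennreal (L - \<epsilon>) * ennreal (s powr (b - 1 - e) * g s)
           \<le> ennreal (s powr (b - 2 - e)) * F s +
             ennreal (L - \<epsilon>) * ennreal (indicator {1..T} s * (s powr (b - 1) * g s))"
          using T
        proof eventually_elim
          case (elim s)
          consider "s \<le> 1" | "1 < s" "s < T" | "1 < s" "T \<le> s" by linarith
          then show ?case
          proof cases
            case 1
            then show ?thesis by (simp add: g_0)
          next
            case 2
            have "ennreal (L - \<epsilon>) * ennreal (s powr (b - 1 - e) * g s) \<le>
              ennreal (L - \<epsilon>) * ennreal (indicator {1..T} s * (s powr (b - 1) * g s))"
              using g_nonneg[of s] 2 e powr1[of s e]
              by (intro ennreal_leI mult_left_mono mult_right_mono) (auto intro!: mult_right_mono)
            then show ?thesis by (simp add: add_increasing)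
          next
            case 3
            have "ennreal (L - \<epsilon>) * ennreal (s powr (b - 1 - e) * g s) =
                ennreal (s powr (b - 2 - e)) * ennreal ((L - \<epsilon>) * (s * g s))"
              using \<epsilon> unfolding powr2[OF 3(1), symmetric]
              by (subst (1 2) ennreal_mult'[symmetric]) (simp_all add: mult_ac)
            also have "\<dots> \<le> ennreal (s powr (b - 2 - e)) * F s"
              using elim 3 by (intro mult_left_mono) auto
            finally show ?thesis by (simp add: add_increasing2)
          qed
        qed
      qed
      also have "\<dots> = M e * I e + ennreal (L - \<epsilon>) * J T"
        by (simp add: nn_integral_add nn_integral_cmult J_def MI)
      finally show ?thesis .
    qed
    define j where "j = enn2real (J T)"
    have J: "J T = ennreal j" "0 \<le> j"
      using local_finite[of T] by (auto simp: j_def J_def)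
    \<comment> \<open>\<open>max A L\<close> dominates both error coefficients, \<open>A\<close>
      from above and \<open>L - \<epsilon>\<close> from below.\<close>
    have "M e < \<infinity> \<and> \<bar>enn2real (M e) - L\<bar> \<le> \<epsilon> + max A L * j / enn2real (I e)"
      if e: "0 < e" and I_pos: "0 < I e" for e
    proof -
      define i where "i = enn2real (I e)"
      have I: "I e = ennreal i" using I_finite[OF e] by (simp add: i_def)
      have i: "0 < i" using I_pos by (simp add: I)
      have *: "M e * I e \<le> ennreal (A * j + (L + \<epsilon>) * i)"
        using up[OF e] A J L \<epsilon> i by (simp add: I ennreal_mult'[symmetric] del: ennreal_plus flip: ennreal_plus)
      have fin: "M e < \<infinity>"
      proof (rule ccontr)
        assume "\<not> M e < \<infinity>"
        then have "M e = top" by (simp add: less_top[symmetric])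
        then show False using * I_pos by (simp add: ennreal_top_mult top_unique split: if_splits)
      qed
      define m where "m = enn2real (M e)"
      have M: "M e = ennreal m" "0 \<le> m" using fin by (auto simp: m_def)
      have 1: "m * i \<le> A * j + (L + \<epsilon>) * i"
        using * A J L \<epsilon> i M by (simp add: I ennreal_mult'[symmetric] del: ennreal_plus)
      have 2: "(L - \<epsilon>) * i \<le> m * i + (L - \<epsilon>) * j"
        using lo[OF e] A J L \<epsilon> i M by (simp add: I ennreal_mult'[symmetric] del: ennreal_plus flip: ennreal_plus)
      have 3: "(L - \<epsilon>) * j \<le> max A L * j" "A * j \<le> max A L * j"
        using J \<epsilon> by (auto intro!: mult_right_mono)
      have "\<bar>m - L\<bar> * i \<le> \<epsilon> * i + max A L * j"
        using 1 2 3 i by (cases "L \<le> m") (auto simp: algebra_simps)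
      then have "\<bar>m - L\<bar> \<le> \<epsilon> + max A L * j / i"
        using i by (simp add: field_simps)
      then show ?thesis using fin by (simp add: m_def i_def)
    qed
    then show ?thesis by blast
  qed
  define e where "e k = 1 / real (Suc k)" for k
  have e: "0 < e k" "e k \<le> 1" for k by (auto simp: e_def)
  define i where "i k = enn2real (I (e k))" for k
  have i_ge: "c / T0 * real (Suc k) \<le> i k" for k
  proof -
    have "ennreal (c / (T0 * e k)) \<le> ennreal (i k)"
      using I_ge[OF e, of k] I_finite[OF e(1), of k] by (simp add: i_def)
    then show ?thesis by (simp add: e_def i_def)
  qed
  have I_pos: "I (e k) > 0" for k
    using I_ge[OF e, of k] c T0 e(1)[of k] by (metis divide_pos_pos ennreal_less_zero_iff less_le_trans mult_pos_pos zero_less_one)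
  have i_lim: "filterlim i at_top sequentially"
  proof (rule filterlim_at_top_mono)
    show "filterlim (\<lambda>k. c / T0 * real (Suc k)) at_top sequentially"
      using c T0 by (intro filterlim_tendsto_pos_mult_at_top[OF tendsto_const] 
            filterlim_compose[OF filterlim_real_sequentially filterlim_Suc]) auto
  qed (use i_ge in auto)
  have "(\<lambda>k. enn2real (M (e k))) \<longlonglongrightarrow> L"
  proof (rule LIMSEQ_I)
    fix \<delta> :: real assume "0 < \<delta>"
    define \<epsilon> where "\<epsilon> = min \<delta> L / 2"
    have \<epsilon>: "0 < \<epsilon>" "\<epsilon> < L" "\<epsilon> \<le> \<delta> / 2" using L \<open>0 < \<delta>\<close> by (auto simp: \<epsilon>_def)
    obtain B where B: "\<And>k. \<bar>enn2real (M (e k)) - L\<bar> \<le> \<epsilon> + B / i k"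
      using sandwich[OF \<epsilon>(1,2)] e I_pos unfolding i_def by blast
    have "(\<lambda>k. B / i k) \<longlonglongrightarrow> 0"
      by (intro tendsto_divide_0[OF tendsto_const] filterlim_at_top_imp_at_infinity i_lim)
    then have "\<forall>\<^sub>F k in sequentially. B / i k < \<delta> / 2"
      by (rule order_tendstoD) (use \<open>0 < \<delta>\<close> in auto)
    then have "\<forall>\<^sub>F k in sequentially. norm (enn2real (M (e k)) - L) < \<delta>"
    proof eventually_elim
      case (elim k)
      then show ?case using B[of k] \<epsilon> unfolding real_norm_def by linarith
    qed
    then show "\<exists>k0. \<forall>k\<ge>k0. norm (enn2real (M (e k)) - L) < \<delta>"
      by (simp add: eventually_sequentially)
  qed
  moreover have "M (e k) = ennreal (enn2real (M (e k)))" for k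
    using sandwich[of "L / 2"] L e I_pos[of k] by auto
  ultimately have "(\<lambda>k. M (e k)) \<longlonglongrightarrow> ennreal L"
    using tendsto_ennrealI by fastforce
  \<comment> \<open>Monotone convergence: \<open>K\<close> lives on t \<ge> 1, where the powers
    increase as the damping decreases.\<close>
  moreover have "(\<lambda>k. M (e k)) \<longlonglongrightarrow> (\<integral>\<^sup>+t. ennreal (t powr (b - 2) * K t) \<partial>lborel)"
    unfolding M_def
  proof (rule nn_integral_LIMSEQ)
    show "incseq (\<lambda>k t. ennreal (t powr (b - 2 - e k) * K t))"
    proof (intro incseq_SucI le_funI ennreal_leI)
      fix k t
      have "e (Suc k) \<le> e k" by (simp add: e_def field_simps)
      then show "t powr (b - 2 - e k) * K t \<le> t powr (b - 2 - e (Suc k)) * K t"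
        using K_0[of t] K_nonneg[of t] by (cases "t < 1") (auto intro!: mult_right_mono powr_mono)
    qed
    have "e \<longlonglongrightarrow> 0" unfolding e_def by (rule LIMSEQ_Suc[OF lim_1_over_n])
    then show "(\<lambda>k. ennreal (t powr (b - 2 - e k) * K t)) \<longlonglongrightarrow> ennreal (t powr (b - 2) * K t)" for t
      using K_0[of t] by (cases "t < 1") (auto intro!: tendsto_eq_intros)
  qed measurable
  ultimately show ?thesis
    by (rule LIMSEQ_unique[symmetric])
qed

section \<open>The density in terms of its profile\<close>

text \<open>This is the product \<open>g\<close> of demand and income density from the idea above.
  The value 0 up to and including y = 1 extends it to the whole line and removes the possible
  singularity at 1.\<close>

definition profile_density :: "real \<Rightarrow> real \<Rightarrow> (real \<Rightarrow> real) \<Rightarrow> real \<Rightarrow> real" where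
  "profile_density b d \<rho> y = (if y \<le> 1 then 0 else y powr -b * (1 - 1 / y) powr d * \<rho> (1 / y))"

lemma profile_density_nonneg:
  assumes "\<And>x. x \<in> {0<..1} \<Longrightarrow> 0 < \<rho> x"
  shows "0 \<le> profile_density b d \<rho> y"
  using assms[of "1 / y"] by (cases "y \<le> 1") (auto simp: profile_density_def intro!: mult_nonneg_nonneg less_imp_le)

text \<open>Isolates the behaviour at 1: \<open>(y - 1) powr d\<close> can be integrated explicitly,
  and the remaining factor is regular there when \<rho> is.\<close>

lemma profile_density_eq_powr_diff:
  assumes "1 < y"
  shows "profile_density b d \<rho> y = y powr (-b - d) * \<rho> (1 / y) * (y - 1) powr d"
proof -
  have "(1 - 1 / y) powr d = ((y - 1) / y) powr d" using assms by (simp add: field_simps)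
  also have "\<dots> = (y - 1) powr d * y powr -d"
    using assms by (simp add: powr_divide powr_minus_divide)
  finally show ?thesis using assms by (simp add: profile_density_def powr_diff powr_minus_divide)
qed

lemma filterlim_inverse_at_left_1: "filterlim (\<lambda>s::real. 1 / s) (at_left 1) (at_right 1)"
  unfolding filterlim_at
proof
  show "\<forall>\<^sub>F s::real in at_right 1. 1 / s \<in> {..<1} \<and> 1 / s \<noteq> 1"
    by (auto simp: eventually_at_filter divide_simps)
qed (auto intro!: tendsto_eq_intros)

section \<open>Consequences of the model assumptions\<close>

context income_model
begin

lemma R_continuous: "continuous_on {1..} R"
proof -
  have "continuous_on {1..} (\<lambda>y. R0 * r y)" by (intro continuous_intros r_continuous)
  then show ?thesis by (rule continuous_on_eq) (use R0_pos r_eq in auto)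
qed

lemma R_1_pos: "0 < R 1"
  using r_1 r_eq[of 1] R0_pos by (simp add: zero_less_divide_iff)

lemma R_tendsto_1: "(R \<longlongrightarrow> R 1) (at_right 1)"
proof -
  have "(R \<longlongrightarrow> R 1) (at 1 within {1..})"
    using R_continuous by (simp add: continuous_on)
  then show ?thesis by (rule tendsto_within_subset) auto
qed

text \<open>The defining identity of \<open>C\<close> turns the coefficient of \<open>n s\<close>
  into \<open>\<sigma> s * (s - 1) * C (1 / s)\<close>, so the demand enters only through the
  product of \<sigma> and n. The lower bound on \<sigma> justifies cancelling it against the
  denominator in the profile.\<close>

lemma balance_profile_density:
  assumes demand: "\<And>y. 1 < y \<Longrightarrow> 1 \<le> \<sigma> y"
    and profile: "has_profile n \<sigma> b d \<rho>" and balance: "solves_balance R R0 P \<sigma> n" and s: "1 < s"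
  shows "((\<lambda>y. R (s / y) * profile_density b d \<rho> y) has_integral
      (s - 1) * C (1 / s) * profile_density b d \<rho> s) {1..s}"
proof -
  have \<sigma>n: "\<sigma> y * n y = profile_density b d \<rho> y" if "1 < y" for y
  proof -
    have "n y = (1 / y) powr b * (1 - 1 / y) powr d * (\<rho> (1 / y) / \<sigma> y)"
      using profile[unfolded has_profile_def, rule_format, of "1 / y"] that by simp
    then show ?thesis
      using demand[OF that] that by (simp add: profile_density_def powr_divide powr_minus_divide)
  qed
  have "((\<lambda>y. \<sigma> y * R (s / y) * n y) has_integral (s - P s + s * \<sigma> s * R0) * n s) {1..s}"
    using balance s unfolding solves_balance_def by simp
  \<comment> \<open>The integrands may differ at y = 1, where the profile says nothing about
    n.\<close>
  then have "((\<lambda>y. R (s / y) * profile_density b d \<rho> y) has_integral (s - P s + s * \<sigma> s * R0) * n s) {1..s}"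
    by (rule has_integral_spike_finite[rotated 2, of _ _ _ "{1}"]) (auto simp: \<sigma>n[symmetric])
  also have "(s - P s + s * \<sigma> s * R0) * n s = (s - 1) * C (1 / s) * profile_density b d \<rho> s"
    using C_eq[OF s] \<sigma>n[OF s] by (simp add: mult_ac)
  finally show ?thesis .
qed

lemma tendsto_C_at_right_1: "((\<lambda>s. C (1 / s)) \<longlongrightarrow> C 1) (at_right 1)"
  by (rule filterlim_compose[OF C_limit_1 filterlim_inverse_at_left_1])

lemma tendsto_C_at_top: "((\<lambda>s. (1 - 1 / s) * C (1 / s)) \<longlongrightarrow> C 0) at_top"
proof -
  have *: "filterlim (\<lambda>s::real. 1 / s) (at_right 0) at_top"
    using filterlim_inverse_at_right_top by (simp add: field_simps)
  then have "((\<lambda>s::real. 1 / s) \<longlongrightarrow> 0) at_top"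
    unfolding filterlim_at by blast
  from tendsto_mult[OF tendsto_diff[OF tendsto_const this] filterlim_compose[OF C_limit_0 *], of 1]
  show ?thesis by simp
qed

text \<open>P is nonnegative, since it decreases and is eventually 0; and 1 \<le> \<sigma> lets s be
  absorbed into \<sigma> s times s. This supplies the global bound \<open>upper\<close> for
  \<open>kernel_moment_eq\<close>.\<close>

lemma C_bound:
  assumes "1 < s" "1 \<le> \<sigma> s"
  shows "(s - 1) * C (1 / s) \<le> (1 + R0) * s"
proof -
  have "0 \<le> P s"
  proof -
    have "\<forall>\<^sub>F t in at_top. P t = 0 \<and> s \<le> t"
      using P_vanishes eventually_ge_at_top by (rule eventually_conj)
    then obtain t where "P t = 0" "s \<le> t" by (auto dest!: eventually_happens)
    then show ?thesis using monotone_onD[OF P_decreasing, of s t] assms by auto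
  qed
  then have "\<sigma> s * ((s - 1) * C (1 / s)) \<le> s + s * \<sigma> s * R0"
    using C_eq[OF assms(1)] by (simp add: mult_ac)
  also have "\<dots> \<le> \<sigma> s * ((1 + R0) * s)"
    using assms by (simp add: algebra_simps)
  finally show ?thesis using assms by simp
qed

section \<open>The exponent d at the minimal income\<close>

text \<open>Near 1 both R and the regular factor of the density are within a relative error \<eta>
  of their limits, hence the squares. The balance integral is thus squeezed between multiples of an
  explicit power integral; first s tends to 1, then \<eta> to 0.\<close>

lemma exponent_at_1:
  assumes d: "-1 < d"
    and demand: "\<And>y. 1 < y \<Longrightarrow> 1 \<le> \<sigma> y"
    and profile: "has_profile n \<sigma> b d \<rho>" and balance: "solves_balance R R0 P \<sigma> n"
    and rho: "(\<rho> \<longlongrightarrow> 1) (at_left 1)"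
  shows "d = R 1 / C 1 - 1"
proof -
  define \<phi> where "\<phi> y = y powr (-b - d) * \<rho> (1 / y)" for y
  have "((\<lambda>y. \<rho> (1 / y)) \<longlongrightarrow> 1) (at_right 1)"
    by (rule filterlim_compose[OF rho filterlim_inverse_at_left_1])
  then have \<phi>: "(\<phi> \<longlongrightarrow> 1) (at_right 1)"
    unfolding \<phi>_def by (auto intro!: tendsto_eq_intros)
  \<comment> \<open>The coefficient of \<open>(s - 1) powr (d + 1)\<close> in the balance integral
    as s tends to 1; the aim is \<open>C 1 = Q\<close>.\<close>
  define Q where "Q = R 1 / (d + 1)"
  have bounds: "(1 - \<eta>)\<^sup>2 * Q \<le> C 1 \<and> C 1 \<le> (1 + \<eta>)\<^sup>2 * Q" if \<eta>: "0 < \<eta>" "\<eta> < 1" for \<eta>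
  proof -
    have "\<forall>\<^sub>F t in at_right 1. (1 - \<eta>) * R 1 < R t \<and> R t < (1 + \<eta>) * R 1"
      using R_1_pos \<eta> by (intro eventually_conj order_tendstoD[OF R_tendsto_1]) auto
    moreover have "\<forall>\<^sub>F t in at_right 1. 1 - \<eta> < \<phi> t \<and> \<phi> t < 1 + \<eta>"
      using \<eta> by (intro eventually_conj order_tendstoD[OF \<phi>]) auto
    ultimately have "\<forall>\<^sub>F t in at_right 1. ((1 - \<eta>) * R 1 < R t \<and> R t < (1 + \<eta>) * R 1) \<and> (1 - \<eta> < \<phi> t \<and> \<phi> t < 1 + \<eta>)"
      by (rule eventually_conj)
    then obtain \<delta> where \<delta>: "1 < \<delta>"
      and near: "\<And>t. 1 < t \<Longrightarrow> t < \<delta> \<Longrightarrow> ((1 - \<eta>) * R 1 < R t \<and> R t < (1 + \<eta>) * R 1) \<and> (1 - \<eta> < \<phi> t \<and> \<phi> t < 1 + \<eta>)"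
      by (subst (asm) eventually_at_right[of 1 2]) auto
    have *: "(1 - \<eta>)\<^sup>2 * Q \<le> C (1 / s) * \<phi> s \<and> C (1 / s) * \<phi> s \<le> (1 + \<eta>)\<^sup>2 * Q" if s: "1 < s" "s < \<delta>" for s
    proof -
      have prod: "(1 - \<eta>)\<^sup>2 * R 1 * (y - 1) powr d \<le> R (s / y) * profile_density b d \<rho> y \<and>
          R (s / y) * profile_density b d \<rho> y \<le> (1 + \<eta>)\<^sup>2 * R 1 * (y - 1) powr d" if y: "y \<in> {1..s}" for y
      \<comment> \<open>At y = 1 all three terms are 0, by the value of the density there and by
        \<open>0 powr d = 0\<close>.\<close>
      proof (cases "y = 1")
        case False
        \<comment> \<open>Both arguments y and s / y stay between 1 and \<delta>. The neighbourhood
          in \<open>near\<close> is punctured, so s / y = 1 is treated separately below.\<close>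
        have sy: "1 \<le> s / y" "s / y < \<delta>" using y s
          by (simp_all add: field_simps) (use mult_mono[of 1 y s s] in \<open>smt (verit) mult_less_cancel_left_pos mult_le_cancel_left1\<close>)
        have R: "(1 - \<eta>) * R 1 \<le> R (s / y)" "R (s / y) \<le> (1 + \<eta>) * R 1"
        proof -
          have "(1 - \<eta>) * R 1 \<le> R (s / y) \<and> R (s / y) \<le> (1 + \<eta>) * R 1"
          proof (cases "s / y = 1")
            case True
            show ?thesis unfolding True using \<eta> R_1_pos by (simp add: algebra_simps)
          next
            case False
            then show ?thesis using near[of "s / y"] sy by linarith
          qed
          then show "(1 - \<eta>) * R 1 \<le> R (s / y)" "R (s / y) \<le> (1 + \<eta>) * R 1" by auto
        qed
        have y': "1 - \<eta> \<le> \<phi> y" "\<phi> y \<le> 1 + \<eta>" "1 < y" using near[of y] y False s by auto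
        have "((1 - \<eta>) * R 1) * (1 - \<eta>) \<le> R (s / y) * \<phi> y"
          using R y' \<eta> R_1_pos R_nonneg[OF sy(1)] by (intro mult_mono) auto
        moreover have "R (s / y) * \<phi> y \<le> ((1 + \<eta>) * R 1) * (1 + \<eta>)"
          using R y' \<eta> R_1_pos R_nonneg[OF sy(1)] by (intro mult_mono) auto
        ultimately have "(1 - \<eta>)\<^sup>2 * R 1 \<le> R (s / y) * \<phi> y" "R (s / y) * \<phi> y \<le> (1 + \<eta>)\<^sup>2 * R 1"
          by (simp_all add: power2_eq_square mult_ac)
        from this[THEN mult_right_mono, of "(y - 1) powr d"] show ?thesis
          using y' by (simp add: profile_density_eq_powr_diff \<phi>_def mult_ac)
      qed (simp add: profile_density_def)
      have int: "((\<lambda>y. R (s / y) * profile_density b d \<rho> y) has_integral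
          C (1 / s) * \<phi> s * (s - 1) powr (d + 1)) {1..s}"
        using balance_profile_density[OF demand profile balance s(1)] s
        by (simp add: profile_density_eq_powr_diff \<phi>_def mult_ac powr_add)
      have pow: "((\<lambda>y. c * R 1 * (y - 1) powr d) has_integral c * Q * (s - 1) powr (d + 1)) {1..s}" for c
        using has_integral_mult_right[OF has_integral_powr_from_1[OF d, of s], of "c * R 1"] s
        by (simp add: Q_def mult_ac)
      show ?thesis
        using has_integral_le[OF pow int] has_integral_le[OF int pow] prod s by simp
    qed
    have ev: "\<forall>\<^sub>F s in at_right 1. (1 - \<eta>)\<^sup>2 * Q \<le> C (1 / s) * \<phi> s \<and> C (1 / s) * \<phi> s \<le> (1 + \<eta>)\<^sup>2 * Q"
      using * \<delta> by (subst eventually_at_right[of 1 2]) auto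
    have lim: "((\<lambda>s. C (1 / s) * \<phi> s) \<longlongrightarrow> C 1) (at_right 1)"
      using tendsto_mult[OF tendsto_C_at_right_1 \<phi>] by simp
    show ?thesis
      by (intro conjI tendsto_lowerbound[OF lim] tendsto_upperbound[OF lim])
        (use ev in \<open>auto elim: eventually_mono\<close>)
  qed
  have ev: "\<forall>\<^sub>F \<eta> in at_right (0::real). (1 - \<eta>)\<^sup>2 * Q \<le> C 1 \<and> C 1 \<le> (1 + \<eta>)\<^sup>2 * Q"
    using bounds by (subst eventually_at_right[of 0 1]) (auto intro!: exI[of _ 1])
  have "Q \<le> C 1"
    by (rule tendsto_upperbound[where F = "at_right (0::real)" and f = "\<lambda>\<eta>. (1 - \<eta>)\<^sup>2 * Q"])
      (use ev in \<open>auto elim: eventually_mono intro!: tendsto_eq_intros\<close>)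
  moreover have "C 1 \<le> Q"
    by (rule tendsto_lowerbound[where F = "at_right (0::real)" and f = "\<lambda>\<eta>. (1 + \<eta>)\<^sup>2 * Q"])
      (use ev in \<open>auto elim: eventually_mono intro!: tendsto_eq_intros\<close>)
  ultimately have "C 1 = R 1 / (d + 1)" by (simp add: Q_def)
  then show ?thesis using R_1_pos d C_1_pos by (simp add: field_simps)
qed

section \<open>Measurability of the density\<close>

lemma lebesgue_measurable_profile_density:
  assumes demand: "\<And>y. 1 < y \<Longrightarrow> 1 \<le> \<sigma> y"
    and profile: "has_profile n \<sigma> b d \<rho>" and balance: "solves_balance R R0 P \<sigma> n"
  shows "profile_density b d \<rho> \<in> borel_measurable lebesgue"
proof -
  \<comment> \<open>Nothing is assumed about the measurability of \<open>\<rho>\<close>. But the integrand of the balance equation is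
    measurable, and \<open>R\<close> can be divided out for \<open>y\<close> close to \<open>s\<close>, where \<open>R (s / y) > 0\<close>.\<close>
  let ?K = "\<lambda>t. indicator {1..} t * R t"
  have K: "?K \<in> borel_measurable borel"
    using borel_measurable_continuous_on_indicator[of "{1..}" R] R_continuous by simp
  have "\<forall>\<^sub>F t in at_right 1. 0 < R t"
    using order_tendstoD(1)[OF R_tendsto_1 R_1_pos] .
  then obtain \<delta>' where \<delta>': "1 < \<delta>'" "\<And>t. 1 < t \<Longrightarrow> t < \<delta>' \<Longrightarrow> 0 < R t"
    by (subst (asm) eventually_at_right[of 1 2]) auto
  \<comment> \<open>Halfway between 1 and \<open>\<delta>'\<close>, so that R is positive on the
    closed interval [1,q].\<close>
  define q where "q = (1 + \<delta>') / 2"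
  have R_pos: "0 < R t" if "1 \<le> t" "t \<le> q" for t
    using \<delta>' that R_1_pos by (cases "t = 1") (auto simp: q_def)
  have q: "1 < q" using \<delta>' by (simp add: q_def)
  \<comment> \<open>A geometric cover of the line: for y in the piece from \<open>q ^ m\<close> to s
    = \<open>q ^ Suc m\<close> the ratio s / y lies in [1,q], so one balance equation per piece
    recovers the density as a quotient.\<close>
  define A where "A k = (case k of 0 \<Rightarrow> {..1} | Suc m \<Rightarrow> {q ^ m..q ^ Suc m})" for k
  show ?thesis
  proof (rule measurable_piecewise_restrict2[of A])
    show "A k \<in> sets lebesgue" for k by (simp add: A_def split: nat.split)
    have "y \<in> (\<Union>k. A k)" for y
    proof (cases "y \<le> 1")
      case True
      then have "y \<in> A 0" by (simp add: A_def)
      then show ?thesis by blast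
    next
      case False
      obtain k where k: "y < q ^ k" using real_arch_pow[OF q] by blast
      define m where "m = (LEAST k. y < q ^ k)"
      have m: "y < q ^ m" unfolding m_def by (rule LeastI[of _ k]) (rule k)
      with False obtain m' where m': "m = Suc m'" by (cases m) auto
      have "\<not> y < q ^ m'" using not_less_Least[of m' "\<lambda>k. y < q ^ k"] by (simp add: m_def[symmetric] m')
      then have "y \<in> A (Suc m')" using m by (simp add: A_def m')
      then show ?thesis by blast
    qed
    then show "space lebesgue = (\<Union>k. A k)" by auto
    show "\<exists>h\<in>borel_measurable lebesgue. \<forall>y\<in>A k. profile_density b d \<rho> y = h y" for k
    proof (cases k)
      case 0
      then show ?thesis by (intro bexI[of _ "\<lambda>_. 0"]) (auto simp: A_def profile_density_def)
    next
      case (Suc m)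
      define s where "s = q ^ Suc m"
      have s: "1 < s" unfolding s_def using q by (intro one_less_power) auto
      let ?h = "\<lambda>y. (indicator {1..s} y * (R (s / y) * profile_density b d \<rho> y)) / ?K (s / y)"
      have 1: "(\<lambda>y. indicator {1..s} y * (R (s / y) * profile_density b d \<rho> y)) \<in> borel_measurable lebesgue"
        using has_integral_implies_lebesgue_measurable_real[OF balance_profile_density[OF demand profile balance s]]
        by (simp add: mult_ac)
      have "(\<lambda>y. ?K (s / y)) \<in> borel_measurable borel"
        by (rule measurable_compose[OF _ K]) measurable
      then have 2: "(\<lambda>y. ?K (s / y)) \<in> borel_measurable lebesgue"
        by (simp add: measurable_completion)
      have "profile_density b d \<rho> y = ?h y" if "y \<in> A k" for y
      proof -
        have y: "q ^ m \<le> y" "y \<le> s" using that by (auto simp: A_def Suc s_def)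
        then have y1: "1 \<le> y" using q one_le_power[of q m] by linarith
        have "1 \<le> s / y" "s / y \<le> q" using y y1 q by (auto simp: field_simps s_def)
        then show ?thesis using R_pos[of "s / y"] y y1 by simp
      qed
      then show ?thesis using borel_measurable_divide[OF 1 2] by (intro bexI[of _ ?h]) auto
    qed
  qed
qed

section \<open>The moment of order b - 2 of the interaction intensity\<close>

text \<open>An application of \<open>kernel_moment_eq\<close> with limit \<open>C 0\<close>. The
  positive limit and the boundedness of \<rho> place the density between multiples of
  \<open>y powr -b\<close> at infinity; the boundedness of \<rho> and d > -1 make its mass finite on
  bounded intervals.\<close>

lemma moment_of_interaction:
  assumes d: "-1 < d"
    and rho_pos: "\<And>x. x \<in> {0<..1} \<Longrightarrow> 0 < \<rho> x"
    and rho_bounded: "bounded (\<rho> ` {0<..1})"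
    and demand: "\<And>y. 1 < y \<Longrightarrow> 1 \<le> \<sigma> y"
    and profile: "has_profile n \<sigma> b d \<rho>" and balance: "solves_balance R R0 P \<sigma> n"
    and rho: "(\<rho> \<longlongrightarrow> \<rho>0) (at_right 0)" and rho0: "0 < \<rho>0" and C_0_pos: "0 < C 0"
  shows "((\<lambda>t. t powr (b - 2) * R t) has_integral C 0) {1..}"
proof -
  define K where "K t = indicator {1..} t * R t" for t
  have K[measurable]: "K \<in> borel_measurable borel"
    using borel_measurable_continuous_on_indicator[of "{1..}" R] R_continuous by (simp add: K_def [abs_def])
  have K_nonneg: "0 \<le> K t" for t by (simp add: K_def R_nonneg indicator_def)
  have K_0: "K t = 0" if "t < 1" for t using that by (simp add: K_def)
  define G where "G = profile_density b d \<rho>"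
  have G_nonneg: "0 \<le> G y" for y
    unfolding G_def by (rule profile_density_nonneg) (rule rho_pos)
  have G_0: "G y = 0" if "y \<le> 1" for y using that by (simp add: G_def profile_density_def)
  \<comment> \<open>Tonelli's theorem is applied to Borel functions, while \<open>G\<close> is only
    known to be Lebesgue measurable. Its Borel version is corrected below so that sign and support
    hold everywhere.\<close>
  obtain g' where [measurable]: "g' \<in> borel_measurable lborel" and g': "AE y in lborel. G y = g' y"
    using completion_ex_borel_measurable_real[OF lebesgue_measurable_profile_density[OF demand profile balance]]
    unfolding G_def by blast
  define g where "g y = (if y \<le> 1 then 0 else max 0 (g' y))" for y
  have g[measurable]: "g \<in> borel_measurable borel" unfolding g_def by measurable
  have g_nonneg: "0 \<le> g y" for y by (simp add: g_def)
  have g_0: "g y = 0" if "y \<le> 1" for y using that by (simp add: g_def)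
  have g_eq: "AE y in lborel. G y = g y"
    using g'
  proof eventually_elim
    case (elim y)
    then show ?case using G_nonneg[of y] by (auto simp: g_def G_0)
  qed
  \<comment> \<open>The integral does not see the change from \<open>G\<close> to \<open>g\<close>,
    so this holds for every s > 1, with \<open>G s\<close> on the right; replacing
    \<open>G s\<close> by \<open>g s\<close> is possible only almost everywhere.\<close>
  have F: "(\<integral>\<^sup>+y. ennreal (K (s / y) * g y) \<partial>lborel) = ennreal ((s - 1) * C (1 / s) * G s)" if s: "1 < s" for s
  proof -
    have "((\<lambda>y. if y \<in> {1..s} then R (s / y) * G y else 0) has_integral (s - 1) * C (1 / s) * G s) UNIV"
      using balance_profile_density[OF demand profile balance s]
      unfolding has_integral_restrict_UNIV G_def .
    moreover have "(if y \<in> {1..s} then R (s / y) * G y else 0) = K (s / y) * G y" for y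
      using s G_0[of y] by (auto simp: K_def indicator_def field_simps)
    ultimately have "((\<lambda>y. K (s / y) * G y) has_integral (s - 1) * C (1 / s) * G s) UNIV"
      by simp
    then have "(\<integral>\<^sup>+y. ennreal (K (s / y) * G y) \<partial>lborel) = ennreal ((s - 1) * C (1 / s) * G s)"
      using K_nonneg G_nonneg
      by (subst (asm) has_integral_iff_nn_integral_lebesgue) (auto simp: nn_integral_completion)
    moreover have "(\<integral>\<^sup>+y. ennreal (K (s / y) * G y) \<partial>lborel) = (\<integral>\<^sup>+y. ennreal (K (s / y) * g y) \<partial>lborel)"
      by (intro nn_integral_cong_AE) (use g_eq in eventually_elim, simp)
    ultimately show ?thesis by simp
  qed
  have F_0: "(\<integral>\<^sup>+y. ennreal (K (s / y) * g y) \<partial>lborel) = 0" if "s \<le> 1" for s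
  proof -
    have *: "K (s / y) * g y = 0" for y
      using that K_0[of "s / y"] g_0[of y] by (cases "y \<le> 1") auto
    show ?thesis by (simp only: * ennreal_0 nn_integral_const mult_zero_left)
  qed
  obtain B where B: "0 < B" "\<And>x. x \<in> {0<..1} \<Longrightarrow> \<rho> x \<le> B"
  proof -
    obtain B where "0 < B" "\<forall>x\<in>\<rho> ` {0<..1}. norm x \<le> B"
      using rho_bounded unfolding bounded_pos by blast
    then show ?thesis by (intro that[of B]) (auto dest: abs_le_D1)
  qed
  \<comment> \<open>Bounds for \<open>x powr d\<close> on [1/2,1]. The power is monotone there, in a
    direction given by the sign of d, so its extremes are the endpoint values.\<close>
  define D where "D = max 1 ((1 / 2) powr d)"
  define D' where "D' = min 1 ((1 / 2) powr d)"
  have D: "0 < D" "0 < D'" by (auto simp: D_def D'_def)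
  have powr_bounds: "D' \<le> x powr d \<and> x powr d \<le> D" if "1 / 2 \<le> x" "x \<le> 1" for x :: real
  proof (cases "0 \<le> d")
    case True
    then have "(1 / 2) powr d \<le> x powr d" "x powr d \<le> 1 powr d" using that by (intro powr_mono2; simp)+
    then show ?thesis by (auto simp: D_def D'_def)
  next
    case False
    then have "x powr d \<le> (1 / 2) powr d" "1 powr d \<le> x powr d" using that by (intro powr_mono2'; simp)+
    then show ?thesis by (auto simp: D_def D'_def)
  qed
  have "\<forall>\<^sub>F x in at_right 0. \<rho>0 / 2 < \<rho> x"
    using rho0 by (intro order_tendstoD(1)[OF rho]) auto
  then obtain \<delta> where \<delta>: "0 < \<delta>" "\<And>x. 0 < x \<Longrightarrow> x < \<delta> \<Longrightarrow> \<rho>0 / 2 < \<rho> x"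
    by (subst (asm) eventually_at_right[of 0 1]) auto
  \<comment> \<open>y \<ge> 2 places 1 - 1/y in [1/2,1], and y \<ge> 2/\<delta> gives 1/y <
    \<delta>.\<close>
  define T0 where "T0 = max 2 (2 / \<delta>)"
  have tail: "D' * (\<rho>0 / 2) * y powr -b \<le> G y \<and> G y \<le> D * B * y powr -b" if y: "T0 \<le> y" for y
  proof -
    have y2: "2 \<le> y" "2 / \<delta> \<le> y" using y by (auto simp: T0_def)
    have "1 / y < \<delta>" using y2 \<delta> by (simp add: field_simps)
    then have r: "\<rho>0 / 2 \<le> \<rho> (1 / y)" "\<rho> (1 / y) \<le> B" using \<delta>(2)[of "1 / y"] B(2)[of "1 / y"] y2 by auto
    have p: "D' \<le> (1 - 1 / y) powr d" "(1 - 1 / y) powr d \<le> D"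
      using powr_bounds[of "1 - 1 / y"] y2 by (auto simp: field_simps)
    have "D' * (\<rho>0 / 2) \<le> (1 - 1 / y) powr d * \<rho> (1 / y)"
      using r p D rho0 by (intro mult_mono) auto
    moreover have "(1 - 1 / y) powr d * \<rho> (1 / y) \<le> D * B"
      using r p D rho0 B by (intro mult_mono) auto
    ultimately show ?thesis using y2
      by (auto simp: G_def profile_density_def mult.assoc mult.left_commute[of _ "y powr -b"] 
          mult.commute[of _ "y powr -b"] intro!: mult_left_mono)
  qed
  have "(\<integral>\<^sup>+t. ennreal (t powr (b - 2) * K t) \<partial>lborel) = ennreal (C 0)"
  proof (rule kernel_moment_eq[where g = g and A = "1 + R0" and ?T0.0 = T0 and c = "D' * (\<rho>0 / 2)" and c' = "D * B"])
    show "AE s in lborel. (\<integral>\<^sup>+y. ennreal (K (s / y) * g y) \<partial>lborel) \<le> ennreal ((1 + R0) * (s * g s))"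
      using g_eq
    proof eventually_elim
      case (elim s)
      show ?case
      proof (cases "1 < s")
        case True
        have "(s - 1) * C (1 / s) * G s \<le> (1 + R0) * s * G s"
          using C_bound[OF True demand[OF True]] G_nonneg by (intro mult_right_mono)
        then show ?thesis using elim by (simp add: F[OF True] mult.assoc ennreal_leI)
      qed (simp add: F_0)
    qed
    show "\<exists>T. AE s in lborel. T \<le> s \<longrightarrow>
        ennreal ((C 0 - \<epsilon>) * (s * g s)) \<le> (\<integral>\<^sup>+y. ennreal (K (s / y) * g y) \<partial>lborel) \<and>
        (\<integral>\<^sup>+y. ennreal (K (s / y) * g y) \<partial>lborel) \<le> ennreal ((C 0 + \<epsilon>) * (s * g s))" if "0 < \<epsilon>" for \<epsilon>
    proof -
      have "\<forall>\<^sub>F s in at_top. C 0 - \<epsilon> < (1 - 1 / s) * C (1 / s) \<and> (1 - 1 / s) * C (1 / s) < C 0 + \<epsilon>"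
        using that by (intro eventually_conj order_tendstoD[OF tendsto_C_at_top]) auto
      then obtain T where T: "\<And>s. T \<le> s \<Longrightarrow> C 0 - \<epsilon> < (1 - 1 / s) * C (1 / s) \<and> (1 - 1 / s) * C (1 / s) < C 0 + \<epsilon>"
        by (auto simp: eventually_at_top_linorder)
      have "AE s in lborel. max 2 T \<le> s \<longrightarrow>
        ennreal ((C 0 - \<epsilon>) * (s * g s)) \<le> (\<integral>\<^sup>+y. ennreal (K (s / y) * g y) \<partial>lborel) \<and>
        (\<integral>\<^sup>+y. ennreal (K (s / y) * g y) \<partial>lborel) \<le> ennreal ((C 0 + \<epsilon>) * (s * g s))"
        using g_eq
      proof eventually_elim
        case (elim s)
        show ?case
        proof
          assume s: "max 2 T \<le> s"
          have eq: "(s - 1) * C (1 / s) * G s = (1 - 1 / s) * C (1 / s) * (s * G s)"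
            using s by (simp add: field_simps)
          have "0 \<le> s * G s" using s G_nonneg[of s] by simp
          with T[of s] s have "(C 0 - \<epsilon>) * (s * G s) \<le> (s - 1) * C (1 / s) * G s"
            "(s - 1) * C (1 / s) * G s \<le> (C 0 + \<epsilon>) * (s * G s)"
            unfolding eq by (intro mult_right_mono; simp)+
          then show "ennreal ((C 0 - \<epsilon>) * (s * g s)) \<le> (\<integral>\<^sup>+y. ennreal (K (s / y) * g y) \<partial>lborel) \<and>
              (\<integral>\<^sup>+y. ennreal (K (s / y) * g y) \<partial>lborel) \<le> ennreal ((C 0 + \<epsilon>) * (s * g s))"
            using s elim by (simp add: F ennreal_leI)
        qed
      qed
      then show ?thesis by (intro exI[of _ "max 2 T"])
    qed
    show "(\<integral>\<^sup>+y. ennreal (indicator {1..T} y * (y powr (b - 1) * g y)) \<partial>lborel) < \<infinity>" for T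
    proof (cases "1 \<le> T")
      case True
      \<comment> \<open>The weighted density equals
        \<open>y powr (- (1 + d)) * \<rho> (1 / y) * (y - 1) powr d\<close>. Here d > -1 serves
        twice: the first factor is at most 1 and the last is integrable at 1.\<close>
      have "((\<lambda>y. B * (y - 1) powr d) has_integral B * ((T - 1) powr (d + 1) / (d + 1))) {1..T}"
        by (intro has_integral_mult_right has_integral_powr_from_1 d True)
      then have "((\<lambda>y. if y \<in> {1..T} then B * (y - 1) powr d else 0) has_integral B * ((T - 1) powr (d + 1) / (d + 1))) UNIV"
        unfolding has_integral_restrict_UNIV .
      then have *: "(\<integral>\<^sup>+y. ennreal (if y \<in> {1..T} then B * (y - 1) powr d else 0) \<partial>lborel) < \<infinity>"
        using B by (subst (asm) has_integral_iff_nn_integral_lebesgue) (auto simp: nn_integral_completion)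
      have "(\<integral>\<^sup>+y. ennreal (indicator {1..T} y * (y powr (b - 1) * g y)) \<partial>lborel)
          \<le> (\<integral>\<^sup>+y. ennreal (if y \<in> {1..T} then B * (y - 1) powr d else 0) \<partial>lborel)"
      proof (rule nn_integral_mono_AE)
        show "AE y in lborel. ennreal (indicator {1..T} y * (y powr (b - 1) * g y))
            \<le> ennreal (if y \<in> {1..T} then B * (y - 1) powr d else 0)"
          using g_eq
        proof eventually_elim
          case (elim y)
          show ?case
          proof (cases "y \<in> {1<..T}")
            case True
            then have "y powr (b - 1) * G y = (y powr (b - 1) * y powr (-b - d)) * \<rho> (1 / y) * (y - 1) powr d"
              by (simp add: G_def profile_density_eq_powr_diff)
            also have "\<dots> = y powr (- (1 + d)) * \<rho> (1 / y) * (y - 1) powr d"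
              by (simp add: powr_add[symmetric])
            also have "\<dots> \<le> 1 * B * (y - 1) powr d"
            proof (intro mult_right_mono mult_mono)
              show "y powr (- (1 + d)) \<le> 1"
                using powr_mono[of "-(1 + d)" 0 y] True d by auto
            qed (use True B rho_pos[of "1 / y"] in auto)
            finally show ?thesis using elim True by (auto intro!: ennreal_leI)
          next
            case False
            then show ?thesis using g_0[of y] by (cases "y = 1") (auto simp: indicator_def)
          qed
        qed
      qed
      also note *
      finally show ?thesis .
    qed simp
    show "AE y in lborel. T0 \<le> y \<longrightarrow> D' * (\<rho>0 / 2) * y powr -b \<le> g y \<and> g y \<le> D * B * y powr -b"
      using g_eq by eventually_elim (use tail in metis)
  qed (use K_nonneg K_0 g_nonneg g_0 C_0_pos R0_pos D B rho0 in \<open>auto simp: T0_def\<close>)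
  then have "((\<lambda>t. t powr (b - 2) * K t) has_integral C 0) UNIV"
    using K_nonneg C_0_pos
    by (subst has_integral_iff_nn_integral_lebesgue) (auto simp: nn_integral_completion measurable_completion)
  moreover have "t powr (b - 2) * K t = (if t \<in> {1..} then t powr (b - 2) * R t else 0)" for t
    by (simp add: K_def)
  ultimately show ?thesis by (simp only: has_integral_restrict_UNIV)
qed

section \<open>Reading off b from the moment\<close>

text \<open>If a were nonzero, \<open>t powr a - 1\<close> would have a strict sign on t > 1. Its
  product with R has integral 0, yet it is continuous and nonzero just to the right of 1, where R is
  positive.\<close>

lemma moment_eq_total_imp:
  assumes moment: "((\<lambda>t. t powr a * R t) has_integral R0) {1..}"
  shows "a = 0"
proof (rule ccontr)
  assume a: "a \<noteq> 0"
  define f where "f t = sgn a * (t powr a - 1) * R t" for t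
  have diff: "(f has_integral 0) {1..}"
    using has_integral_mult_right[OF has_integral_diff[OF moment R_integral], of "sgn a"]
    by (simp add: f_def [abs_def] algebra_simps)
  have sgn: "0 < sgn a * (t powr a - 1)" if "1 < t" for t
    using that a powr_less_mono[of 0 a t] powr_less_mono[of a 0 t] by (cases "0 < a") auto
  have nonneg: "0 \<le> f t" if "1 \<le> t" for t
    using that R_nonneg[OF that] sgn[of t] unfolding f_def
    by (cases "t = 1") (auto intro!: mult_nonneg_nonneg[OF less_imp_le])
  have "\<forall>\<^sub>F t in at_right 1. 0 < R t"
    using order_tendstoD(1)[OF R_tendsto_1 R_1_pos] .
  \<comment> \<open>A point beyond 1 is needed, because \<open>f\<close> vanishes at 1
    itself.\<close>
  then obtain u where u: "1 < u" "0 < R u"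
    by (subst (asm) eventually_at_right[of 1 2]) (auto dest: dense)
  have cont: "continuous_on {1..u} f"
    unfolding f_def by (intro continuous_intros continuous_on_subset[OF R_continuous]) auto
  have "integral {1..u} f \<le> integral {1..} f"
    using nonneg by (intro integral_subset_le integrable_continuous_interval[OF cont] has_integral_integrable[OF diff]) auto
  also have "\<dots> = 0" using diff by (rule integral_unique)
  finally have "integral {1..u} f = 0"
    using nonneg by (intro antisym integral_nonneg integrable_continuous_interval[OF cont]) auto
  then have "(f has_integral 0) (cbox 1 u)"
    using integrable_integral[OF integrable_continuous_interval[OF cont]] by simp
  then have "f u = 0"
    using cont nonneg u by (intro has_integral_0_cbox_imp_0[of 1 u f]) auto
  moreover have "0 < f u" unfolding f_def by (rule mult_pos_pos[OF sgn[OF u(1)] u(2)])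
  ultimately show False by simp
qed

text \<open>For a \<le> 0 the weight is at most 1 on t \<ge> 1, which bounds the moment by the total
  mass \<open>R0\<close>.\<close>

lemma moment_gt_total_imp:
  assumes "((\<lambda>t. t powr a * R t) has_integral m) {1..}" and "R0 < m"
  shows "0 < a"
proof (rule ccontr)
  assume "\<not> 0 < a"
  then have "t powr a * R t \<le> R t" if "1 \<le> t" for t
    using that R_nonneg[OF that] powr_mono[of a 0 t] by (intro mult_left_le_one_le) auto
  then have "m \<le> R0" using has_integral_le[OF assms(1) R_integral] by auto
  then show False using assms(2) by simp
qed

end

section \<open>The exponents for the three demand classes\<close>

theorem theorem1:
  fixes R r P \<sigma> C n \<rho> :: "real \<Rightarrow> real" and R0 dP b d :: real
  assumes model: "income_model R R0 r P dP \<sigma> C"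
    and b: "1 < b" and d: "-1 < d"
    and rho_pos: "\<And>x. x \<in> {0<..1} \<Longrightarrow> 0 < \<rho> x"
    and rho_bounded: "bounded (\<rho> ` {0<..1})"
    and rho_1: "\<rho> 1 = 1"
    and profile: "has_profile n \<sigma> b d \<rho>"
    and balance: "solves_balance R R0 P \<sigma> n"
  shows
    "(continuous_on {1..} \<sigma> \<and> \<sigma> 1 = 1 \<and> continuous (at 1 within {0<..1}) \<rho>
        \<longrightarrow> d = R 1 / C 1 - 1) \<and>
     (continuous (at 0 within {0..1}) \<rho> \<and> 0 < \<rho> 0 \<longrightarrow>
        (l_demand \<sigma> \<longrightarrow>
           b = 2 \<and> (\<forall>x\<in>{0<..<1}. n (1 / x) = x powr 3 * (1 - x) powr d * \<rho> x)) \<and>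
        (u_demand \<sigma> \<longrightarrow> b = 2) \<and>
        (\<forall>S0. s_demand \<sigma> S0 \<longrightarrow>
           2 < b \<and> ((\<lambda>s. s powr (b - 2) * r s) has_integral (1 + 1 / (S0 * R0))) {1..}))"
proof -
  interpret income_model R R0 r P dP \<sigma> C by (rule model)
  have ge_1: "1 \<le> \<sigma> y" if "\<sigma> 1 = 1" "1 \<le> y" for y
    using monotone_onD[OF demand_mono, of 1 y] that by auto
  have part_i: "d = R 1 / C 1 - 1" if "\<sigma> 1 = 1" "continuous (at 1 within {0<..1}) \<rho>"
  proof (rule exponent_at_1[OF d _ profile balance])
    have "at_left (1::real) = at 1 within {0<..1}"
      by (rule at_within_nhd[of _ "{0<..}"]) auto
    then show "(\<rho> \<longlongrightarrow> 1) (at_left 1)"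
      using that(2) rho_1 by (simp add: continuous_within)
  qed (use ge_1 that in auto)
  have moment: "((\<lambda>t. t powr (b - 2) * R t) has_integral C 0) {1..}"
    if "continuous (at 0 within {0..1}) \<rho>" "0 < \<rho> 0" "\<And>y. 1 < y \<Longrightarrow> 1 \<le> \<sigma> y" "0 < C 0"
  proof (rule moment_of_interaction[OF d rho_pos rho_bounded that(3) profile balance])
    show "(\<rho> \<longlongrightarrow> \<rho> 0) (at_right 0)"
      using that(1) by (simp add: continuous_within at_within_Icc_at_right)
  qed (use that in auto)
  have "b = 2 \<and> (\<forall>x\<in>{0<..<1}. n (1 / x) = x powr 3 * (1 - x) powr d * \<rho> x)"
    if "continuous (at 0 within {0..1}) \<rho>" "0 < \<rho> 0" and l: "l_demand \<sigma>"
  proof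
    have \<sigma>: "\<sigma> s = s" if "1 < s" for s using l that by (simp add: l_demand_def)
    have "filterlim \<sigma> at_top at_top"
      using filterlim_ident
      by (rule filterlim_mono_eventually) (auto intro: eventually_mono[OF eventually_gt_at_top[of 1]] simp: \<sigma>)
    \<comment> \<open>For unbounded demand the moment of order b - 2 thus equals the total mass,
      which forces the order to be 0.\<close>
    then have "C 0 = R0" by (rule C_0_infinite)
    with moment[OF that(1,2)] \<sigma> R0_pos have "((\<lambda>t. t powr (b - 2) * R t) has_integral R0) {1..}" by auto
    from moment_eq_total_imp[OF this] show b2: "b = 2" by simp
    show "\<forall>x\<in>{0<..<1}. n (1 / x) = x powr 3 * (1 - x) powr d * \<rho> x"
    proof
      \<comment> \<open>Division by \<open>\<sigma> (1 / x) = 1 / x\<close> contributes one more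
        factor x: the density itself has exponent 3, although the exponent b in front of the
        quotient \<rho> / \<sigma> is 2.\<close>
      fix x :: real assume x: "x \<in> {0<..<1}"
      then show "n (1 / x) = x powr 3 * (1 - x) powr d * \<rho> x"
        using profile \<sigma>[of "1 / x"] unfolding has_profile_def b2
        by (auto simp: powr_numeral power3_eq_cube power2_eq_square)
    qed
  qed
  moreover have "b = 2"
    if "continuous (at 0 within {0..1}) \<rho>" "0 < \<rho> 0" and u: "u_demand \<sigma>"
  proof -
    have \<sigma>1: "\<sigma> 1 = 1" using u by (auto simp: u_demand_def)
    have "C 0 = R0" using u by (intro C_0_infinite) (simp add: u_demand_def)
    with moment[OF that(1,2)] ge_1[OF \<sigma>1] R0_pos have "((\<lambda>t. t powr (b - 2) * R t) has_integral R0) {1..}" by auto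
    from moment_eq_total_imp[OF this] show ?thesis by simp
  qed
  moreover have "2 < b \<and> ((\<lambda>s. s powr (b - 2) * r s) has_integral (1 + 1 / (S0 * R0))) {1..}"
    if "continuous (at 0 within {0..1}) \<rho>" "0 < \<rho> 0" and s: "s_demand \<sigma> S0" for S0
  proof
    have \<sigma>1: "\<sigma> 1 = 1" using s by (auto simp: s_demand_def)
    have lim: "(\<sigma> \<longlongrightarrow> S0) at_top" using s by (simp add: s_demand_def)
    \<comment> \<open>This makes 1 / S0 positive, so \<open>C 0\<close> strictly exceeds
      \<open>R0\<close> and the order of the moment must be positive.\<close>
    have "1 \<le> S0"
      by (rule tendsto_lowerbound[OF lim])
        (auto intro: eventually_mono[OF eventually_ge_at_top[of 1]] ge_1[OF \<sigma>1])
    then have C0: "C 0 = R0 + 1 / S0" "R0 < C 0" using C_0_finite[OF lim] by auto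
    have m: "((\<lambda>t. t powr (b - 2) * R t) has_integral C 0) {1..}"
      using moment[OF that(1,2)] ge_1[OF \<sigma>1] R0_pos C0 by auto
    from moment_gt_total_imp[OF m C0(2)] show "2 < b" by simp
    \<comment> \<open>Normalising by \<open>R0\<close> turns R into r and gives the transcendental
      equation.\<close>
    have "((\<lambda>t. t powr (b - 2) * R t / R0) has_integral C 0 / R0) {1..}"
      using has_integral_divide[OF m] .
    also have "C 0 / R0 = 1 + 1 / (S0 * R0)"
      using R0_pos C0 by (simp add: add_divide_distrib)
    finally show "((\<lambda>s. s powr (b - 2) * r s) has_integral (1 + 1 / (S0 * R0))) {1..}"
      by (rule has_integral_eq[rotated]) (simp add: r_eq)
  qed
  ultimately show ?thesis using part_i by blast
qed

end
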